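(* Let $f:\mathbb{R}^d\to\mathbb{R}$ be convex, differentiable, $L$-smooth on $\mathcal{D}$, and satisfy the $\mu$-quadratic growth condition on $\mathcal{D}$. Let $\mathcal{X}^*=\arg\min_{\bm x\in\mathcal{D}}f(\bm x)$ and assume that $\|\bm x^*\|_2=C$ for every $\bm x^*\in\mathcal{X}^*$. Let $\delta=1$ and let $(\bm x_t)_{t\ge0}$ be generated by DMO-AccFW. Then for all $t\ge1$, $$h(\bm x_t)=f(\bm x_t)-\min_{\mathcal{D}}f\ \le\ \frac{4e^{4L/\mu}\,h(\bm x_0)}{(t+2)^2}.$$
   Context: Setting: $\mathbb{M}=\{S_1,\dots,S_m\}$ is a collection of subsets of $[d]=\{1,\dots,d\}$ with $\bigcup_iS_i=[d]$ (each $S_i$ being associated with a subgraph of an underlying graph on $[d]$), $C>0$, and $$\mathcal{D}=\operatorname{conv}\{\bm x\in\mathbb{R}^d:\|\bm x\|_2\le C,\ \operatorname{supp}(\bm x)\subseteq S\text{ for some }S\in\mathbb{M}\}.$$ For $S\subseteq[d]$, $\bm z_S$ keeps the entries of $\bm z$ indexed by $S$ and sets the others to $0$. $f$ is $L$-smooth on $\mathcal{D}$ ($L>0$) if $f(\bm x)-f(\bm y)-\langle\nabla f(\bm y),\bm x-\bm y\rangle\le\frac L2\|\bm x-\bm y\|_2^2$ for all $\bm x,\bm y\in\mathcal{D}$. $f$ satisfies the $\mu$-quadratic growth condition on $\mathcal{D}$ ($\mu>0$) if, with $[\bm x]_{\mathcal{X}^*}=\arg\min_{\bm z\in\mathcal{X}^*}\|\bm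 z-\bm x\|_2^2$, one has $f(\bm x)-\min_{\mathcal{D}}f\ge\frac\mu2\|\bm x-[\bm x]_{\mathcal{X}^*}\|_2^2$ for all $\bm x\in\mathcal{D}$. DMO-AccFW with $\delta=1$: start from any $\bm x_0\in\mathcal{D}$, use step sizes $\eta_t=2/(t+2)$, and for $t=0,1,\dots$ set $\bm z_t=\bm x_t-\frac{1}{L\eta_t}\nabla f(\bm x_t)$, choose any $S_t\in\arg\max_{S\in\mathbb{M}}\|(\bm z_t)_S\|_2$, set $\tilde{\bm v}_t=C(\bm z_t)_{S_t}/\|(\bm z_t)_{S_t}\|_2$, and $\bm x_{t+1}=\bm x_t+\eta_t(\tilde{\bm v}_t-\bm x_t)$. It is assumed that $\bm z_t\neq 0$ at every iteration, so that $\tilde{\bm v}_t$ is well defined. *)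

theory Defs
  imports "HOL-Analysis.Analysis"
begin

definition support :: "real ^ 'd \<Rightarrow> 'd set" where
  "support x = {i. x $ i \<noteq> 0}"

definition restrict_to :: "'d set \<Rightarrow> real ^ 'd \<Rightarrow> real ^ 'd" where
  "restrict_to S z = (\<chi> i. if i \<in> S then z $ i else 0)"

definition feasible_set :: "'d::finite set set \<Rightarrow> real \<Rightarrow> (real ^ 'd) set" where
  "feasible_set M C = convex hull {x. norm x \<le> C \<and> (\<exists>S\<in>M. support x \<subseteq> S)}"

text \<open>Below, \<open>g\<close> plays the role of the gradient of \<open>f\<close>; the link between the two is
  a hypothesis of the theorem (\<open>GDERIV f x :> g x\<close>).\<close>

definition smooth_on_with ::
  "real \<Rightarrow> 'a::real_inner set \<Rightarrow> ('a \<Rightarrow> real) \<Rightarrow> ('a \<Rightarrow> 'a) \<Rightarrow> bool" where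
  "smooth_on_with L D f g \<longleftrightarrow>
     (\<forall>x\<in>D. \<forall>y\<in>D. f x - f y - inner (g y) (x - y) \<le> L / 2 * (norm (x - y))\<^sup>2)"

definition minimizers :: "('a \<Rightarrow> real) \<Rightarrow> 'a set \<Rightarrow> 'a set" where
  "minimizers f D = {x. is_arg_min f (\<lambda>y. y \<in> D) x}"

text \<open>\<open>min_value f D\<close> is the minimum of \<open>f\<close> over \<open>D\<close>. It is meaningful only if the minimum
  is attained, which is the case for a continuous \<open>f\<close> and the compact nonempty feasible set.\<close>

definition min_value :: "('a \<Rightarrow> real) \<Rightarrow> 'a set \<Rightarrow> real" where
  "min_value f D = (LEAST v. v \<in> f ` D)"

text \<open>\<open>closest_point X x\<close> is the point of \<open>X\<close> nearest to \<open>x\<close>. It is unique when \<open>X\<close> is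
  closed, convex and nonempty, as the set of minimizers is in the theorem.\<close>

definition quadratic_growth_on ::
  "real \<Rightarrow> 'a::{real_inner,heine_borel} set \<Rightarrow> ('a \<Rightarrow> real) \<Rightarrow> bool" where
  "quadratic_growth_on \<mu> D f \<longleftrightarrow>
     (\<forall>x\<in>D. f x - min_value f D
        \<ge> \<mu> / 2 * (norm (x - closest_point (minimizers f D) x))\<^sup>2)"

definition step_size :: "nat \<Rightarrow> real" where
  "step_size t = 2 / (real t + 2)"

definition acc_point :: "real \<Rightarrow> ('a::real_vector \<Rightarrow> 'a) \<Rightarrow> nat \<Rightarrow> 'a \<Rightarrow> 'a" where
  "acc_point L g t x = x - (1 / (L * step_size t)) *\<^sub>R g x"

definition dmo_vertex :: "real \<Rightarrow> 'd::finite set \<Rightarrow> real ^ 'd \<Rightarrow> real ^ 'd" where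
  "dmo_vertex C S z = (C / norm (restrict_to S z)) *\<^sub>R restrict_to S z"

text \<open>\<open>x\<close> is a sequence of iterates produced by DMO-AccFW with \<open>\<delta> = 1\<close>, where \<open>S t\<close>
  is the (arbitrary) maximizing support chosen in iteration \<open>t\<close>.\<close>

definition DMO_AccFW ::
  "'d::finite set set \<Rightarrow> real \<Rightarrow> real \<Rightarrow> (real ^ 'd \<Rightarrow> real ^ 'd)
     \<Rightarrow> (nat \<Rightarrow> 'd set) \<Rightarrow> (nat \<Rightarrow> real ^ 'd) \<Rightarrow> bool" where
  "DMO_AccFW M C L g S x \<longleftrightarrow>
     x 0 \<in> feasible_set M C \<and>
     (\<forall>t. let z = acc_point L g t (x t) in
        is_arg_max (\<lambda>T. norm (restrict_to T z)) (\<lambda>T. T \<in> M) (S t) \<and>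
        x (Suc t) = x t + step_size t *\<^sub>R (dmo_vertex C (S t) z - x t))"

end

theory Submission
  imports Defs
begin

text \<open>The method owes its rate to the assumption that all minimizers lie on the sphere of
  radius \<open>C\<close>. Completing the square turns the quadratic upper model
  \<open>\<langle>g x, w - x\<rangle> + L \<eta> / 2 * \<parallel>w - x\<parallel>\<^sup>2\<close> into
  \<open>L \<eta> / 2 * \<parallel>w\<parallel>\<^sup>2 - L \<eta> * \<langle>z, w\<rangle>\<close> plus a constant, where \<open>z\<close> is the gradient step. Among the
  feasible points of norm \<open>C\<close> the quadratic term is fixed, so minimizing the model is the same
  as maximizing the linear form \<open>\<langle>z, w\<rangle>\<close>. The vertex chosen by the algorithm has norm \<open>C\<close> and
  maximizes this form over the entire feasible set
  (\<open>inner_le_inner_dmo_vertex\<close>), hence it is as good in the model as any minimizer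
  (\<open>upper_model_le\<close>).

  Comparing with the minimizer nearest to the current iterate, convexity bounds the linear term
  of the model by \<open>- h\<close>, where \<open>h\<close> is the optimality gap, and quadratic growth bounds the
  quadratic term by a multiple of \<open>h\<close>. One iteration therefore multiplies \<open>h\<close> by at most
  \<open>1 - \<eta> + (L / \<mu>) \<eta>\<^sup>2\<close> (\<open>optimality_gap_step\<close>). With \<open>\<eta> = 2 / (t + 2)\<close> the factors
  \<open>1 - \<eta>\<close> multiply to order \<open>1 / t\<^sup>2\<close>, while the squared steps are summable and cost only a
  constant factor exponential in \<open>L / \<mu>\<close> (\<open>gap_recurrence_bound\<close>).\<close>

section \<open>Tangent planes of convex functions\<close>

text \<open>Along the line from \<open>y\<close> to \<open>x\<close> the function is convex in one real variable, and its
  derivative at \<open>y\<close> is the inner product with the gradient; the one-dimensional tangent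
  inequality then applies.\<close>

lemma convex_on_above_gradient:
  fixes f :: "'a::real_inner \<Rightarrow> real"
  assumes "convex_on UNIV f" and "GDERIV f y :> g"
  shows "f y + inner g (x - y) \<le> f x"
proof -
  define \<phi> where "\<phi> s = f (y + s *\<^sub>R (x - y))" for s :: real
  have "convex_on UNIV \<phi>"
  proof (rule convex_onI)
    fix t a b :: real
    assume "0 < t" "t < 1"
    have "y + ((1 - t) *\<^sub>R a + t *\<^sub>R b) *\<^sub>R (x - y)
      = (1 - t) *\<^sub>R (y + a *\<^sub>R (x - y)) + t *\<^sub>R (y + b *\<^sub>R (x - y))"
      by (simp add: algebra_simps)
    then show "\<phi> ((1 - t) *\<^sub>R a + t *\<^sub>R b) \<le> (1 - t) * \<phi> a + t * \<phi> b"
      unfolding \<phi>_def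
      using convex_onD[OF assms(1), of t "y + a *\<^sub>R (x - y)" "y + b *\<^sub>R (x - y)"]
        \<open>0 < t\<close> \<open>t < 1\<close> by simp
  qed simp
  moreover have "(\<phi> has_real_derivative inner g (x - y)) (at 0)"
  proof -
    have f: "(f has_derivative (\<lambda>h. inner h g)) (at (y + 0 *\<^sub>R (x - y)))"
      using assms(2) by (simp add: gderiv_def)
    have "((\<lambda>s::real. y + s *\<^sub>R (x - y)) has_derivative (\<lambda>s. s *\<^sub>R (x - y))) (at 0)"
      by (auto intro!: derivative_eq_intros)
    from has_derivative_compose[OF this f]
    show ?thesis
      unfolding \<phi>_def has_field_derivative_def
      by (simp add: inner_commute mult_commute_abs)
  qed
  ultimately have "\<phi> 1 - \<phi> 0 \<ge> inner g (x - y) * (1 - 0)"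
    by (intro convex_on_imp_above_tangent[where A = UNIV]) auto
  then show ?thesis by (simp add: \<phi>_def)
qed

section \<open>Linear maximization over the feasible set\<close>

lemma compact_feasible_set:
  fixes M :: "'d::finite set set"
  shows "compact (feasible_set M C)"
proof -
  have "{x :: real ^ 'd. norm x \<le> C \<and> (\<exists>S\<in>M. support x \<subseteq> S)}
    = (\<Union>S\<in>M. cball 0 C \<inter> (\<Inter>i\<in>- S. {x. x $ i = 0}))"
    by (auto simp: support_def)
  moreover have "compact (\<Union>S\<in>M. cball 0 C \<inter> (\<Inter>i\<in>- S. {x :: real ^ 'd. x $ i = 0}))"
    by (intro compact_UN compact_Int_closed closed_INT ballI closed_Collect_eq
        continuous_intros) auto
  ultimately show ?thesis
    unfolding feasible_set_def by (simp add: compact_convex_hull)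
qed

lemma convex_feasible_set: "convex (feasible_set M C)"
  by (simp add: feasible_set_def)

lemma inner_restrict_to_eq:
  fixes z :: "real ^ 'd::finite"
  assumes "support v \<subseteq> T"
  shows "inner (restrict_to T z) v = inner z v"
  unfolding inner_vec_def using assms
  by (intro sum.cong) (auto simp: restrict_to_def support_def)

lemma support_restrict_to: "support (restrict_to T z) \<subseteq> T"
  by (auto simp: support_def restrict_to_def)

lemma inner_restrict_to_self: "inner z (restrict_to T z) = (norm (restrict_to T z))\<^sup>2"
  for z :: "real ^ 'd::finite"
  using inner_restrict_to_eq[OF support_restrict_to, of T z z]
  by (simp add: power2_norm_eq_inner)

text \<open>Since the sets in \<open>M\<close> cover all coordinates, some restriction of a nonzero \<open>z\<close> is
  nonzero, and so is one of maximal norm: the normalization in \<open>dmo_vertex\<close> does not divide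
  by zero.\<close>

lemma norm_restrict_to_pos:
  fixes z :: "real ^ 'd::finite"
  assumes "\<Union>M = UNIV" and "z \<noteq> 0"
    and "is_arg_max (\<lambda>T. norm (restrict_to T z)) (\<lambda>T. T \<in> M) S"
  shows "norm (restrict_to S z) > 0"
proof -
  obtain i where i: "z $ i \<noteq> 0"
    using assms(2) by (auto simp: vec_eq_iff)
  obtain T where T: "T \<in> M" "i \<in> T"
    using assms(1) UNIV_I[of i] by (metis UnionE)
  then have "restrict_to T z $ i \<noteq> 0"
    using i by (simp add: restrict_to_def)
  then have "norm (restrict_to T z) > 0"
    by auto
  also have "norm (restrict_to T z) \<le> norm (restrict_to S z)"
    using assms(3) T(1) by (auto simp: is_arg_max_linorder)
  finally show ?thesis .
qed

lemma norm_dmo_vertex: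
  assumes "C \<ge> 0" and "norm (restrict_to S z) > 0"
  shows "norm (dmo_vertex C S z) = C"
  using assms by (simp add: dmo_vertex_def)

lemma dmo_vertex_feasible:
  assumes "C \<ge> 0" and "norm (restrict_to S z) > 0" and "S \<in> M"
  shows "dmo_vertex C S z \<in> feasible_set M C"
proof -
  have "support (dmo_vertex C S z) \<subseteq> S"
    by (auto simp: support_def dmo_vertex_def restrict_to_def)
  with assms norm_dmo_vertex[OF assms(1,2)] show ?thesis
    unfolding feasible_set_def by (intro hull_inc) auto
qed

text \<open>A linear form is maximized over a convex hull by one of the generating points. On the
  generators supported in \<open>T\<close> the form sees only the restriction of \<open>z\<close> to \<open>T\<close>, so by
  Cauchy--Schwarz its maximum there is \<open>C\<close> times the norm of this restriction; the
  algorithm picks the best \<open>T\<close> and the vertex attaining equality.\<close>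

lemma inner_le_inner_dmo_vertex:
  fixes z :: "real ^ 'd::finite"
  assumes "C \<ge> 0" and pos: "norm (restrict_to S z) > 0"
    and S: "is_arg_max (\<lambda>T. norm (restrict_to T z)) (\<lambda>T. T \<in> M) S"
    and "y \<in> feasible_set M C"
  shows "inner z y \<le> inner z (dmo_vertex C S z)"
proof -
  have "inner z v \<le> C * norm (restrict_to S z)"
    if v: "norm v \<le> C" "T \<in> M" "support v \<subseteq> T" for v T
  proof -
    have "inner z v = inner (restrict_to T z) v"
      by (simp add: inner_restrict_to_eq[OF v(3)])
    also have "\<dots> \<le> norm (restrict_to T z) * norm v"
      by (rule norm_cauchy_schwarz)
    also have "\<dots> \<le> norm (restrict_to S z) * C"
      using v(1,2) S by (intro mult_mono) (auto simp: is_arg_max_linorder)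
    finally show ?thesis by (simp add: mult.commute)
  qed
  then have "feasible_set M C \<subseteq> {v. inner z v \<le> C * norm (restrict_to S z)}"
    unfolding feasible_set_def
    by (intro hull_minimal convex_halfspace_le) auto
  moreover have "inner z (dmo_vertex C S z) = C * norm (restrict_to S z)"
    using pos by (simp add: dmo_vertex_def inner_restrict_to_self power2_eq_square)
  ultimately show ?thesis using assms(4) by auto
qed

section \<open>Decrease of the optimality gap in one iteration\<close>

text \<open>Completing the square around \<open>x - (1 / a) g\<close> leaves \<open>a / 2 * \<parallel>w\<parallel>\<^sup>2\<close> and a multiple of the
  linear form as the only terms that depend on \<open>w\<close>. Equality of the norms cancels the
  first.\<close>

lemma upper_model_le:
  fixes x v y g :: "'a::real_inner"
  assumes "a > 0" and "norm v = norm y"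
    and "inner (x - (1 / a) *\<^sub>R g) y \<le> inner (x - (1 / a) *\<^sub>R g) v"
  shows "inner g (v - x) + a / 2 * (norm (v - x))\<^sup>2
    \<le> inner g (y - x) + a / 2 * (norm (y - x))\<^sup>2"
proof -
  have model: "inner g (w - x) + a / 2 * (norm (w - x))\<^sup>2
      = a / 2 * (norm w)\<^sup>2 - a * inner (x - (1 / a) *\<^sub>R g) w
        + (a / 2 * (norm x)\<^sup>2 - inner g x)" for w
    using assms(1) unfolding power2_norm_eq_inner
    by (simp add: inner_diff_left inner_diff_right inner_commute algebra_simps)
  have "a * inner (x - (1 / a) *\<^sub>R g) y \<le> a * inner (x - (1 / a) *\<^sub>R g) v"
    using assms(1,3) by (intro mult_left_mono) auto
  then show ?thesis unfolding model using assms(2) by simp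
qed

lemma min_value_eq:
  assumes "y \<in> minimizers f D"
  shows "min_value f D = f y"
  using assms unfolding minimizers_def min_value_def is_arg_min_linorder
  by (intro Least_equality) auto

text \<open>By compactness and continuity the set of minimizers is closed and nonempty, so the
  projection in the growth condition is itself a minimizer.\<close>

lemma closest_point_minimizers:
  fixes f :: "'a::{real_inner,heine_borel} \<Rightarrow> real"
  assumes "compact D" and "D \<noteq> {}" and "continuous_on D f"
  shows "closest_point (minimizers f D) x \<in> minimizers f D"
proof (rule closest_point_in_set)
  obtain y where y: "y \<in> D" "\<And>w. w \<in> D \<Longrightarrow> f y \<le> f w"
    using continuous_attains_inf[OF assms] by blast
  then show "minimizers f D \<noteq> {}"
    by (auto simp: minimizers_def is_arg_min_linorder)
  have "minimizers f D = D \<inter> f -` {..f y}"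
    unfolding minimizers_def is_arg_min_linorder using y by (blast intro: order_trans)
  then show "closed (minimizers f D)"
    using assms by (simp add: continuous_closed_preimage compact_imp_closed)
qed

text \<open>By smoothness the function changes by at most \<open>\<eta>\<close> times the value of the model at \<open>v\<close>,
  which is at most its value at the nearest minimizer \<open>y\<close>. There the linear part is at most minus the
  gap by convexity, and the quadratic part is at most \<open>(L / \<mu>) \<eta>\<close> times the gap by quadratic growth.\<close>

lemma optimality_gap_step:
  fixes f :: "'a::{real_inner,heine_borel} \<Rightarrow> real"
  assumes "L > 0" "\<mu> > 0" "0 < \<eta>"
    and convex: "convex_on UNIV f" and gradient: "GDERIV f x :> g x"
    and smooth: "smooth_on_with L D f g" and growth: "quadratic_growth_on \<mu> D f"
    and x: "x \<in> D" and x': "x + \<eta> *\<^sub>R (v - x) \<in> D"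
    and y: "y = closest_point (minimizers f D) x" "y \<in> minimizers f D"
    and norms: "norm v = norm y"
    and max: "inner (x - (1 / (L * \<eta>)) *\<^sub>R g x) y \<le> inner (x - (1 / (L * \<eta>)) *\<^sub>R g x) v"
  shows "f (x + \<eta> *\<^sub>R (v - x)) - min_value f D
    \<le> (1 - \<eta> + L / \<mu> * \<eta>\<^sup>2) * (f x - min_value f D)"
proof -
  let ?h = "f x - min_value f D"
  have "f (x + \<eta> *\<^sub>R (v - x)) - f x \<le> inner (g x) (\<eta> *\<^sub>R (v - x)) + L / 2 * (norm (\<eta> *\<^sub>R (v - x)))\<^sup>2"
    using smooth x x' unfolding smooth_on_with_def by force
  also have "\<dots> = \<eta> * (inner (g x) (v - x) + L * \<eta> / 2 * (norm (v - x))\<^sup>2)"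
    unfolding norm_scaleR inner_scaleR_right
    by (simp add: power_mult_distrib power2_eq_square distrib_left mult_ac)
  also have "\<dots> \<le> \<eta> * (inner (g x) (y - x) + L * \<eta> / 2 * (norm (y - x))\<^sup>2)"
    using assms(1,3) norms max by (intro mult_left_mono upper_model_le) auto
  also have "\<dots> \<le> \<eta> * (- ?h + L * \<eta> / 2 * (2 / \<mu> * ?h))"
  proof (intro mult_left_mono add_mono)
    show "inner (g x) (y - x) \<le> - ?h"
      using convex_on_above_gradient[OF convex gradient, of y] min_value_eq[OF y(2)] by simp
    have "\<mu> / 2 * (norm (y - x))\<^sup>2 \<le> ?h"
      using growth x by (simp add: quadratic_growth_on_def y(1) norm_minus_commute)
    then show "(norm (y - x))\<^sup>2 \<le> 2 / \<mu> * ?h"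
      using \<open>\<mu> > 0\<close> by (simp add: field_simps)
  qed (use assms(1-3) in auto)
  also have "\<dots> = (- \<eta> + L / \<mu> * \<eta>\<^sup>2) * ?h"
    using \<open>\<mu> > 0\<close> by (simp add: field_simps power2_eq_square)
  finally show ?thesis by (simp add: algebra_simps)
qed

section \<open>Solving the recurrence\<close>

text \<open>The first step has \<open>\<eta> = 1\<close>, so it contributes only the factor \<open>\<kappa>\<close>. For \<open>t \<ge> 1\<close> the factor
  equals \<open>t / (t + 2) * (1 + 4 \<kappa> / (t (t + 2)))\<close>. The first parts multiply to
  \<open>2 / (t (t + 1))\<close>. The second parts are at most \<open>exp (4 \<kappa> / (t (t + 2)))\<close>, whose exponents
  telescope to \<open>\<kappa> (3 - 2 / t - 2 / (t + 1))\<close>.\<close>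

lemma gap_recurrence_telescoped:
  fixes h :: "nat \<Rightarrow> real"
  assumes "\<kappa> \<ge> 0" and "h 0 \<ge> 0"
    and step: "\<And>t. h (Suc t) \<le> (1 - step_size t + \<kappa> * (step_size t)\<^sup>2) * h t"
    and "t \<ge> 1"
  shows "h t \<le> \<kappa> * exp (\<kappa> * (3 - 2 / real t - 2 / (real t + 1)))
    * (2 / (real t * (real t + 1))) * h 0"
  using \<open>t \<ge> 1\<close>
proof (induction t rule: dec_induct)
  case base
  show ?case using step[of 0] by (simp add: step_size_def)
next
  case (step t)
  define r where "r = real t"
  have r: "r \<ge> 1" using step.hyps by (simp add: r_def)
  define E where "E s = exp (\<kappa> * (3 - 2 / s - 2 / (s + 1)))" for s :: real
  have factor: "1 - step_size t + \<kappa> * (step_size t)\<^sup>2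
      = r / (r + 2) * (1 + \<kappa> * (4 / (r * (r + 2))))"
    using r by (simp add: step_size_def r_def[symmetric] divide_simps power2_eq_square)
  have "h (Suc t) \<le> r / (r + 2) * (1 + \<kappa> * (4 / (r * (r + 2)))) * h t"
    using assms(3)[of t] unfolding factor .
  also have "\<dots> \<le> r / (r + 2) * (1 + \<kappa> * (4 / (r * (r + 2))))
      * (\<kappa> * E r * (2 / (r * (r + 1))) * h 0)"
    using step.IH r assms(1) unfolding r_def[symmetric] E_def
    by (intro mult_left_mono) auto
  also have "\<dots> \<le> r / (r + 2) * exp (\<kappa> * (4 / (r * (r + 2))))
      * (\<kappa> * E r * (2 / (r * (r + 1))) * h 0)"
    using r assms(1,2) by (intro mult_right_mono mult_left_mono exp_ge_add_one_self)
      (auto simp: E_def)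
  also have "\<dots> = \<kappa> * (exp (\<kappa> * (4 / (r * (r + 2)))) * E r)
      * (r / (r + 2) * (2 / (r * (r + 1)))) * h 0"
    by (simp only: mult_ac)
  also have "exp (\<kappa> * (4 / (r * (r + 2)))) * E r = E (r + 1)"
  proof -
    have "4 / (r * (r + 2)) + (3 - 2 / r - 2 / (r + 1)) = 3 - 2 / (r + 1) - 2 / (r + 2)"
      using r by (simp add: divide_simps) (simp add: algebra_simps)
    then show ?thesis
      unfolding E_def exp_add[symmetric] distrib_left[symmetric] by (simp add: add.assoc)
  qed
  also have "r / (r + 2) * (2 / (r * (r + 1))) = 2 / ((r + 1) * (r + 1 + 1))"
    using r by (simp add: divide_simps)
  finally show ?case by (simp add: E_def r_def add.commute)
qed

text \<open>Two elementary inequalities convert the telescoped bound into its final form: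
  \<open>9 / 4 * \<kappa> \<le> exp \<kappa>\<close>, which absorbs the leading factor \<open>\<kappa>\<close> into the exponential, and
  \<open>2 (t + 2)\<^sup>2 \<le> 9 t (t + 1)\<close>, which is an equality at \<open>t = 1\<close>.\<close>

lemma gap_recurrence_bound:
  fixes h :: "nat \<Rightarrow> real"
  assumes "\<kappa> \<ge> 0" and "h 0 \<ge> 0"
    and "\<And>t. h (Suc t) \<le> (1 - step_size t + \<kappa> * (step_size t)\<^sup>2) * h t"
    and "t \<ge> 1"
  shows "h t \<le> 4 * exp (4 * \<kappa>) * h 0 / (real t + 2)\<^sup>2"
proof -
  define r where "r = real t"
  have r: "r \<ge> 1" using \<open>t \<ge> 1\<close> by (simp add: r_def)
  have "9 / 4 * \<kappa> \<le> 1 + \<kappa> + \<kappa>\<^sup>2 / 2"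
    using zero_le_power2[of "\<kappa> - 5 / 4"] by (simp add: power2_eq_square algebra_simps)
  also have "\<dots> \<le> exp \<kappa>"
    using assms(1) by (rule exp_lower_Taylor_quadratic)
  finally have kappa: "\<kappa> \<le> 4 / 9 * exp \<kappa>" by simp
  have "2 * (r + 2)\<^sup>2 \<le> 9 * (r * (r + 1))"
  proof -
    have "0 \<le> (r - 1) * (7 * r + 8)" using r by simp
    then show ?thesis by (simp add: power2_eq_square algebra_simps)
  qed
  then have rate: "2 / (r * (r + 1)) \<le> 9 / (r + 2)\<^sup>2"
    using r by (simp add: frac_le_eq divide_simps)
  have "h t \<le> \<kappa> * exp (\<kappa> * (3 - 2 / r - 2 / (r + 1))) * (2 / (r * (r + 1))) * h 0"
    using gap_recurrence_telescoped[of \<kappa> h, OF assms] by (simp add: r_def)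
  also have "\<dots> \<le> (4 / 9 * exp \<kappa>) * exp (3 * \<kappa>) * (9 / (r + 2)\<^sup>2) * h 0"
  proof (intro mult_right_mono mult_mono kappa rate)
    have "\<kappa> * (3 - 2 / r - 2 / (r + 1)) \<le> \<kappa> * 3"
    proof (rule mult_left_mono)
      have "2 / r \<ge> 0" and "2 / (r + 1) \<ge> 0" using r by auto
      then show "3 - 2 / r - 2 / (r + 1) \<le> 3" by linarith
    qed (rule assms(1))
    then show "exp (\<kappa> * (3 - 2 / r - 2 / (r + 1))) \<le> exp (3 * \<kappa>)"
      by (simp add: mult.commute)
  qed (use r assms(1,2) in auto)
  also have "\<dots> = 4 * (exp \<kappa> * exp (3 * \<kappa>)) * h 0 / (r + 2)\<^sup>2"
    by simp
  also have "exp \<kappa> * exp (3 * \<kappa>) = exp (4 * \<kappa>)"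
    by (simp add: exp_add[symmetric])
  finally show ?thesis by (simp add: r_def)
qed

section \<open>Convergence rate\<close>

theorem theorem5p7:
  fixes M :: "'d::finite set set"
    and C L \<mu> :: real
    and f :: "real ^ 'd \<Rightarrow> real"
    and g :: "real ^ 'd \<Rightarrow> real ^ 'd"
    and S :: "nat \<Rightarrow> 'd set"
    and x :: "nat \<Rightarrow> real ^ 'd"
  defines "D \<equiv> feasible_set M C"
  assumes cover: "\<Union>M = UNIV"
    and C_pos: "C > 0" and L_pos: "L > 0" and mu_pos: "\<mu> > 0"
    and convex: "convex_on UNIV f"
    and gradient: "\<And>y. GDERIV f y :> g y"
    and smooth: "smooth_on_with L D f g"
    and growth: "quadratic_growth_on \<mu> D f"
    and norm_opt: "\<And>y. y \<in> minimizers f D \<Longrightarrow> norm y = C"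
    and generated: "DMO_AccFW M C L g S x"
    and z_nonzero: "\<And>t. acc_point L g t (x t) \<noteq> 0"
  shows "\<forall>t\<ge>1. f (x t) - min_value f D
           \<le> 4 * exp (4 * L / \<mu>) * (f (x 0) - min_value f D) / (real t + 2)\<^sup>2"
proof -
  define z where "z t = acc_point L g t (x t)" for t
  define v where "v t = dmo_vertex C (S t) (z t)" for t
  have S: "is_arg_max (\<lambda>T. norm (restrict_to T (z t))) (\<lambda>T. T \<in> M) (S t)"
    and x_Suc: "x (Suc t) = x t + step_size t *\<^sub>R (v t - x t)" for t
    using generated by (auto simp: DMO_AccFW_def Let_def z_def v_def)
  have pos: "norm (restrict_to (S t) (z t)) > 0" for t
    using norm_restrict_to_pos[OF cover _ S] z_nonzero by (simp add: z_def)
  have v_D: "v t \<in> D" for t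
    unfolding v_def D_def using C_pos pos S
    by (intro dmo_vertex_feasible) (auto simp: is_arg_max_linorder)
  have eta: "0 < step_size t" "step_size t \<le> 1" for t
    by (auto simp: step_size_def)
  have x_D: "x t \<in> D" for t
  proof (induction t)
    case 0
    show ?case using generated by (simp add: DMO_AccFW_def D_def)
  next
    case (Suc t)
    have "x (Suc t) = (1 - step_size t) *\<^sub>R x t + step_size t *\<^sub>R v t"
      by (simp add: x_Suc algebra_simps)
    also have "\<dots> \<in> D"
      using Suc v_D[of t] eta[of t] convex_feasible_set unfolding D_def
      by (intro convexD_alt) auto
    finally show ?case .
  qed
  have "continuous_on D f"
    using gradient
    by (meson gderiv_def has_derivative_continuous continuous_at_imp_continuous_on)
  then have y: "closest_point (minimizers f D) w \<in> minimizers f D" for w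
    using compact_feasible_set x_D by (intro closest_point_minimizers) (auto simp: D_def)
  have y_D: "closest_point (minimizers f D) w \<in> D" for w
    using y[of w] by (simp add: minimizers_def is_arg_min_linorder)
  define h where "h t = f (x t) - min_value f D" for t
  have "h (Suc t) \<le> (1 - step_size t + L / \<mu> * (step_size t)\<^sup>2) * h t" for t
    unfolding h_def x_Suc
  proof (rule optimality_gap_step[OF L_pos mu_pos eta(1) convex gradient smooth growth x_D _ refl y])
    show "x t + step_size t *\<^sub>R (v t - x t) \<in> D"
      using x_D[of "Suc t"] by (simp add: x_Suc)
    show "norm (v t) = norm (closest_point (minimizers f D) (x t))"
      using norm_dmo_vertex[OF _ pos] C_pos norm_opt[OF y] by (simp add: v_def)
    show "inner (x t - (1 / (L * step_size t)) *\<^sub>R g (x t)) (closest_point (minimizers f D) (x t))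
        \<le> inner (x t - (1 / (L * step_size t)) *\<^sub>R g (x t)) (v t)"
      using inner_le_inner_dmo_vertex[OF _ pos[of t] S[of t], of C] C_pos y_D[of "x t"]
      by (simp add: v_def z_def acc_point_def D_def)
  qed
  moreover have "h 0 \<ge> 0"
    using y[of "x 0"] min_value_eq[OF y, of "x 0"] x_D[of 0]
    by (auto simp: h_def minimizers_def is_arg_min_linorder)
  ultimately have "h t \<le> 4 * exp (4 * (L / \<mu>)) * h 0 / (real t + 2)\<^sup>2" if "t \<ge> 1" for t
    using gap_recurrence_bound[of "L / \<mu>" h] that L_pos mu_pos by simp
  then show ?thesis by (simp add: h_def)
qed

end
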